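(* There exists a continuous map $g:\mathbb{D}^2\to Sub_3(\mathbb{D}^2)$ that admits no homological selection; that is, the map $$H_2(\mathrm{gr}(g),\mathrm{gr}(\partial g))\to H_2(\mathbb{D}^2,\partial\mathbb{D}^2)$$ induced by the projection $(x,y)\mapsto x$ is zero.
   Context: $\mathbb{D}^2$ is the closed unit disk in $\mathbb{R}^2$. $Sub_3(\mathbb{D}^2)$ is the space of non-empty subsets of $\mathbb{D}^2$ with at most $3$ points, with the Hausdorff metric. $\mathrm{gr}(g)=\{(x,y)\in\mathbb{D}^2\times\mathbb{D}^2: y\in g(x)\}$ and $\mathrm{gr}(\partial g)=\{(x,y)\in\mathrm{gr}(g): x\in\partial\mathbb{D}^2\}$. Homology is singular homology with integer coefficients. A homological selection of $g$ is a non-zero $2$-chain supported in $\mathrm{gr}(g)$, with boundary supported in $\mathrm{gr}(\partial g)$, whose class in $H_2(\mathrm{gr}(g),\mathrm{gr}(\partial g))$ has non-zero image in $H_2(\mathbb{D}^2,\partial\mathbb{D}^2)$ under the projection. *)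

theory Defs
  imports "HOL-Analysis.Analysis" "HOL-Homology.Homology"
begin

abbreviation disk :: "(real ^ 2) set"
  where "disk \<equiv> cball 0 1"

text \<open>The value 0 outside the non-empty bounded sets is a convention; the locale
  \<^locale>\<open>Metric_space\<close> wants non-negativity for all arguments.\<close>

definition hausdorff_dist :: "'a::metric_space set \<Rightarrow> 'a set \<Rightarrow> real"
  where "hausdorff_dist A B =
    (if A = {} \<or> B = {} \<or> \<not> bounded A \<or> \<not> bounded B then 0
     else max (SUP a\<in>A. infdist a B) (SUP b\<in>B. infdist b A))"

text \<open>Infinite sets have cardinality 0, so finiteness is required explicitly.\<close>

definition Sub :: "nat \<Rightarrow> 'a set \<Rightarrow> 'a set set"
  where "Sub k M = {A. A \<subseteq> M \<and> A \<noteq> {} \<and> finite A \<and> card A \<le> k}"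

definition Sub_topology :: "nat \<Rightarrow> 'a::metric_space set \<Rightarrow> 'a set topology"
  where "Sub_topology k M = Metric_space.mtopology (Sub k M) hausdorff_dist"

text \<open>Outside its locale, \<^const>\<open>Metric_space.mtopology\<close> is meaningful only for a genuine
  metric; \<open>Metric_space_Sub\<close> below shows that this is the case here.\<close>

lemma hausdorff_dist_commute: "hausdorff_dist A B = hausdorff_dist B A"
  by (auto simp: hausdorff_dist_def max.commute)

lemma hausdorff_dist_nonneg: "0 \<le> hausdorff_dist A B"
proof (cases "A = {} \<or> B = {} \<or> \<not> bounded A \<or> \<not> bounded B")
  case False
  then obtain a b where a: "a \<in> A" and b: "b \<in> B" by blast
  obtain r where r: "\<And>x. x \<in> A \<Longrightarrow> dist b x \<le> r"
    using False by (metis bounded_any_center)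
  have "infdist x B \<le> r" if "x \<in> A" for x
    using infdist_le2[OF b, of x r] r[OF that] by (simp add: dist_commute)
  then have "bdd_above ((\<lambda>x. infdist x B) ` A)"
    by (rule bdd_aboveI2)
  then have "infdist a B \<le> (SUP x\<in>A. infdist x B)"
    using a by (intro cSUP_upper)
  then show ?thesis
    using False infdist_nonneg[of a B] by (simp add: hausdorff_dist_def le_max_iff_disj)
qed (simp add: hausdorff_dist_def)

lemma hausdorff_dist_le_iff:
  fixes A B :: "'a::metric_space set"
  assumes "finite A" "A \<noteq> {}" "finite B" "B \<noteq> {}"
  shows "hausdorff_dist A B \<le> r \<longleftrightarrow> (\<forall>a\<in>A. infdist a B \<le> r) \<and> (\<forall>b\<in>B. infdist b A \<le> r)"
proof -
  have "(SUP a\<in>A. infdist a B) \<le> r \<longleftrightarrow> (\<forall>a\<in>A. infdist a B \<le> r)"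
    using assms by (intro cSUP_le_iff) auto
  moreover have "(SUP b\<in>B. infdist b A) \<le> r \<longleftrightarrow> (\<forall>b\<in>B. infdist b A \<le> r)"
    using assms by (intro cSUP_le_iff) auto
  ultimately show ?thesis
    using assms by (simp add: hausdorff_dist_def finite_imp_bounded)
qed

lemma infdist_le_hausdorff_dist_add:
  fixes A B C :: "'a::metric_space set"
  assumes A: "finite A" "A \<noteq> {}" and B: "finite B" "B \<noteq> {}" and C: "finite C" "C \<noteq> {}"
    and a: "a \<in> A"
  shows "infdist a C \<le> hausdorff_dist A B + hausdorff_dist B C"
proof -
  have "Min (dist a ` B) \<in> dist a ` B"
    using B by (intro Min_in) auto
  then obtain b where "b \<in> B" "Min (dist a ` B) = dist a b"
    by (rule imageE) auto
  then have b: "b \<in> B" "infdist a B = dist a b"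
    using B by (simp_all add: infdist_def cInf_eq_Min)
  have "infdist a C \<le> infdist b C + dist a b"
    by (rule infdist_triangle)
  moreover have "infdist a B \<le> hausdorff_dist A B"
    using hausdorff_dist_le_iff[OF A B, of "hausdorff_dist A B"] a by simp
  moreover have "infdist b C \<le> hausdorff_dist B C"
    using hausdorff_dist_le_iff[OF B C, of "hausdorff_dist B C"] b by simp
  ultimately show ?thesis
    using b by simp
qed

lemma hausdorff_dist_eq_0_iff:
  fixes A B :: "'a::metric_space set"
  assumes A: "finite A" "A \<noteq> {}" and B: "finite B" "B \<noteq> {}"
  shows "hausdorff_dist A B = 0 \<longleftrightarrow> A = B"
proof -
  have "hausdorff_dist A B = 0 \<longleftrightarrow> hausdorff_dist A B \<le> 0"
    using hausdorff_dist_nonneg[of A B] by linarith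
  also have "\<dots> \<longleftrightarrow> (\<forall>a\<in>A. infdist a B = 0) \<and> (\<forall>b\<in>B. infdist b A = 0)"
    by (simp add: hausdorff_dist_le_iff[OF A B] infdist_nonneg order.eq_iff)
  also have "\<dots> \<longleftrightarrow> (\<forall>a\<in>A. a \<in> B) \<and> (\<forall>b\<in>B. b \<in> A)"
    using A B by (simp add: in_closed_iff_infdist_zero finite_imp_closed)
  also have "\<dots> \<longleftrightarrow> A = B"
    by blast
  finally show ?thesis .
qed

lemma Metric_space_Sub: "Metric_space (Sub k M) hausdorff_dist"
proof
  show "0 \<le> hausdorff_dist A B" for A B :: "'a set"
    by (rule hausdorff_dist_nonneg)
  show "hausdorff_dist A B = hausdorff_dist B A" for A B :: "'a set"
    by (rule hausdorff_dist_commute)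
  show "hausdorff_dist A B = 0 \<longleftrightarrow> A = B" if "A \<in> Sub k M" "B \<in> Sub k M" for A B
    using that by (intro hausdorff_dist_eq_0_iff) (auto simp: Sub_def)
  show "hausdorff_dist A C \<le> hausdorff_dist A B + hausdorff_dist B C"
    if "A \<in> Sub k M" "B \<in> Sub k M" "C \<in> Sub k M" for A B C
  proof -
    have fin: "finite A" "A \<noteq> {}" "finite B" "B \<noteq> {}" "finite C" "C \<noteq> {}"
      using that by (auto simp: Sub_def)
    have "infdist c A \<le> hausdorff_dist A B + hausdorff_dist B C" if "c \<in> C" for c
      using infdist_le_hausdorff_dist_add[of C B A c] fin that
      by (simp add: hausdorff_dist_commute add.commute)
    then show ?thesis
      using infdist_le_hausdorff_dist_add[of A B C] fin by (simp add: hausdorff_dist_le_iff)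
  qed
qed

lemma topspace_Sub_topology: "topspace (Sub_topology k M) = Sub k M"
  by (simp add: Sub_topology_def Metric_space.topspace_mtopology[OF Metric_space_Sub])

definition gr :: "(real ^ 2 \<Rightarrow> (real ^ 2) set) \<Rightarrow> ((real ^ 2) \<times> (real ^ 2)) set"
  where "gr g = {(x, y) \<in> disk \<times> disk. y \<in> g x}"

definition gr_bd :: "(real ^ 2 \<Rightarrow> (real ^ 2) set) \<Rightarrow> ((real ^ 2) \<times> (real ^ 2)) set"
  where "gr_bd g = {(x, y) \<in> gr g. x \<in> sphere 0 1}"

definition gr_homology :: "(real ^ 2 \<Rightarrow> (real ^ 2) set) \<Rightarrow> ((real ^ 2) \<times> (real ^ 2)) chain set monoid"
  where "gr_homology g = relative_homology_group 2 (top_of_set (gr g)) (gr_bd g)"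

definition disk_homology :: "(real ^ 2) chain set monoid"
  where "disk_homology = relative_homology_group 2 (top_of_set disk) (sphere 0 1)"

definition proj_induced ::
    "(real ^ 2 \<Rightarrow> (real ^ 2) set) \<Rightarrow> ((real ^ 2) \<times> (real ^ 2)) chain set \<Rightarrow> (real ^ 2) chain set"
  where "proj_induced g =
    hom_induced 2 (top_of_set (gr g)) (gr_bd g) (top_of_set disk) (sphere 0 1) fst"

text \<open>\<^const>\<open>hom_induced\<close> is trivial by convention unless the map is a continuous map of pairs,
  which the projection always is.\<close>

lemma fst_map_of_pairs:
  "continuous_map (top_of_set (gr g)) (top_of_set disk) fst" "fst \<in> gr_bd g \<rightarrow> sphere 0 1"
  by (auto simp: gr_def gr_bd_def intro!: continuous_intros)

definition homological_selection ::
    "(real ^ 2 \<Rightarrow> (real ^ 2) set) \<Rightarrow> ((real ^ 2) \<times> (real ^ 2)) chain \<Rightarrow> bool"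
  where "homological_selection g c \<longleftrightarrow>
    c \<noteq> 0 \<and>
    singular_chain 2 (top_of_set (gr g)) c \<and>
    singular_chain 1 (top_of_set (gr_bd g)) (chain_boundary 2 c) \<and>
    proj_induced g (homologous_rel_set 2 (top_of_set (gr g)) (gr_bd g) c) \<noteq> \<one>\<^bsub>disk_homology\<^esub>"

end

theory Submission
  imports Defs
begin

text \<open>The loop \<open>x \<mapsto> {x}\<close> is null-homotopic in the space of non-empty subsets of the circle with at
  most 3 points, so there is a continuous \<open>g\<close> on the disk, with values in that space, such that
  \<open>g x = {x}\<close> for \<open>x\<close> on the boundary circle. The two projections of \<open>gr g\<close> then agree on
  \<open>gr_bd g\<close>, so the straight-line homotopy between them is one of maps of pairs into
  (disk, circle), and they induce the same map in homology. The second projection factors through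
  the pair (circle, circle), whose homology vanishes.

  An explicit null-homotopy exists because points of a set carry no multiplicities: a pair of
  points can be read as a triple with either of its two points doubled.\<close>

section \<open>Continuity of maps into spaces of finite subsets\<close>

text \<open>Points with equal index are matched: where each of the finitely many \<open>f i\<close>
  moves by less than \<open>e/2\<close>, the two sets are within \<open>e/2\<close>. Points may
  collide, as \<open>f i x\<close> need not be injective in \<open>i\<close>.\<close>

lemma continuous_map_image_Sub:
  fixes M :: "'b::metric_space set"
  assumes I: "finite I" "I \<noteq> {}" "card I \<le> k"
    and f: "\<And>i. i \<in> I \<Longrightarrow> continuous_map X (top_of_set M) (f i)"
  shows "continuous_map X (Sub_topology k M) (\<lambda>x. (\<lambda>i. f i x) ` I)"
  unfolding Sub_topology_def Metric_space.continuous_map_to_metric[OF Metric_space_Sub]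
proof (intro ballI allI impI)
  fix x and e :: real
  assume x: "x \<in> topspace X" and e: "e > 0"
  \<comment> \<open>Half of \<open>e\<close>, since the bound in \<open>close\<close> is not strict
    while \<open>mball\<close> is open.\<close>
  define U where "U i = {y \<in> topspace X. f i y \<in> ball (f i x) (e/2)}" for i
  have U: "openin X (U i)" if "i \<in> I" for i
    unfolding U_def using f[OF that]
    by (intro openin_continuous_map_preimage[where Y = euclidean])
       (auto simp: continuous_map_in_subtopology)
  have in_Sub: "(\<lambda>i. f i y) ` I \<in> Sub k M" if "y \<in> topspace X" for y
    using that f I card_image_le[of I "\<lambda>i. f i y"]
    by (force simp: Sub_def continuous_map_in_subtopology)
  have close: "hausdorff_dist ((\<lambda>i. f i x) ` I) ((\<lambda>i. f i y) ` I) \<le> e/2"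
    if y: "\<And>i. i \<in> I \<Longrightarrow> y \<in> U i" for y
  proof -
    have d: "dist (f i x) (f i y) \<le> e/2" if "i \<in> I" for i
      using y[OF that] by (simp add: U_def)
    have "infdist (f i x) ((\<lambda>i. f i y) ` I) \<le> e/2" "infdist (f i y) ((\<lambda>i. f i x) ` I) \<le> e/2"
      if "i \<in> I" for i
      using infdist_le2[OF imageI[OF that, of "\<lambda>i. f i y"] d[OF that]]
        infdist_le2[OF imageI[OF that, of "\<lambda>i. f i x"], of "f i y" "e/2"] d[OF that]
      by (simp_all add: dist_commute)
    then show ?thesis
      using I by (subst hausdorff_dist_le_iff) auto
  qed
  show "\<exists>V. openin X V \<and> x \<in> V \<and> (\<forall>y\<in>V. (\<lambda>i. f i y) ` I \<in>
      Metric_space.mball (Sub k M) hausdorff_dist ((\<lambda>i. f i x) ` I) e)"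
  proof (intro exI conjI ballI)
    show "openin X (\<Inter>i\<in>I. U i)"
      using I U by (intro openin_INT2) auto
    show "x \<in> (\<Inter>i\<in>I. U i)"
      using x e by (simp add: U_def)
    fix y assume y: "y \<in> (\<Inter>i\<in>I. U i)"
    then have "y \<in> topspace X"
      using I by (auto simp: U_def)
    with y show "(\<lambda>i. f i y) ` I \<in>
        Metric_space.mball (Sub k M) hausdorff_dist ((\<lambda>i. f i x) ` I) e"
      using close[of y] e in_Sub x by (simp add: Metric_space.in_mball[OF Metric_space_Sub])
  qed
qed

section \<open>Parametrization of the unit circle\<close>

text \<open>Angles are measured in full turns, so every integer gives the base point
  \<open>circ 0\<close>.\<close>

definition circ :: "real \<Rightarrow> real ^ 2"
  where "circ t = vector [cos (2 * pi * t), sin (2 * pi * t)]"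

lemma norm_vector_2: "norm (vector [x, y] :: real ^ 2) = sqrt (x\<^sup>2 + y\<^sup>2)"
  by (simp add: norm_vec_def L2_set_def UNIV_2)

lemma norm_circ [simp]: "norm (circ t) = 1"
  by (simp add: circ_def norm_vector_2)

lemma circ_eq_iff: "circ t = circ u \<longleftrightarrow> (\<exists>n::int. t = u + n)"
proof -
  have "circ t = circ u \<longleftrightarrow> sin (2 * pi * t) = sin (2 * pi * u) \<and> cos (2 * pi * t) = cos (2 * pi * u)"
    by (auto simp: circ_def vec_eq_iff forall_2)
  also have "\<dots> \<longleftrightarrow> (\<exists>n::int. 2 * pi * t = 2 * pi * u + 2 * pi * n)"
    by (rule sin_cos_eq_iff)
  also have "\<dots> \<longleftrightarrow> (\<exists>n::int. 2 * pi * t = 2 * pi * (u + n))"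
    by (simp add: distrib_left)
  finally show ?thesis
    by simp
qed

lemma circ_add_1 [simp]: "circ (1 + t) = circ t"
  unfolding circ_eq_iff by (rule exI[of _ 1]) simp

lemma circ_1 [simp]: "circ 1 = circ 0"
  using circ_add_1[of 0] by simp

lemma continuous_on_circ [continuous_intros]:
  fixes f :: "'a::t2_space \<Rightarrow> real"
  assumes "continuous_on S f"
  shows "continuous_on S (\<lambda>x. circ (f x))"
proof -
  have "continuous_on S (\<lambda>x. \<chi> i. circ (f x) $ i)"
  proof (rule continuous_on_vec_lambda)
    fix i :: 2
    have "continuous_on S (\<lambda>x. cos (2 * pi * f x))" "continuous_on S (\<lambda>x. sin (2 * pi * f x))"
      by (intro continuous_intros assms)+
    then show "continuous_on S (\<lambda>x. circ (f x) $ i)"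
      using exhaust_2[of i] by (auto simp: circ_def)
  qed
  then show ?thesis by simp
qed

lemma sphere_imp_circ:
  assumes "norm (x :: real ^ 2) = 1"
  obtains t where "0 \<le> t" "t \<le> 1" "x = circ t"
proof -
  have "(x $ 1)\<^sup>2 + (x $ 2)\<^sup>2 = 1"
    using assms by (simp add: norm_vec_def L2_set_def UNIV_2)
  then obtain u where u: "0 \<le> u" "u < 2 * pi" "x $ 1 = cos u" "x $ 2 = sin u"
    by (rule sincos_total_2pi)
  show ?thesis
  proof
    show "x = circ (u / (2 * pi))"
      using u by (simp add: circ_def vec_eq_iff forall_2)
  qed (use u in auto)
qed

section \<open>The disk as a quotient of the square\<close>

abbreviation unit_square :: "(real \<times> real) set"
  where "unit_square \<equiv> {0..1} \<times> {0..1}"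

definition polar :: "real \<times> real \<Rightarrow> real ^ 2"
  where "polar = (\<lambda>(s, t). s *\<^sub>R circ t)"

lemma polar_image: "polar ` unit_square = disk"
proof
  show "polar ` unit_square \<subseteq> disk"
    by (auto simp: polar_def)
  show "disk \<subseteq> polar ` unit_square"
  proof
    fix x :: "real ^ 2" assume x: "x \<in> disk"
    show "x \<in> polar ` unit_square"
    proof (cases "x = 0")
      case True
      then have "x = polar (0, 0)"
        by (simp add: polar_def)
      then show ?thesis
        by (rule image_eqI) simp
    next
      case False
      then have "norm (x /\<^sub>R norm x) = 1"
        by simp
      then obtain t where t: "0 \<le> t" "t \<le> 1" "x /\<^sub>R norm x = circ t"
        by (rule sphere_imp_circ)
      have "x = polar (norm x, t)"
        using False by (simp add: polar_def flip: t(3))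
      then show ?thesis
        using t x by (intro image_eqI) auto
    qed
  qed
qed

text \<open>A continuous surjection from a compact onto a Hausdorff space is closed, hence a
  quotient map. Maps on the disk can thus be constructed on the square.\<close>

lemma quotient_map_polar: "quotient_map (top_of_set unit_square) (top_of_set disk) polar"
proof (rule continuous_closed_imp_quotient_map)
  have "continuous_on unit_square polar"
    unfolding polar_def case_prod_unfold by (intro continuous_intros)
  then show cont: "continuous_map (top_of_set unit_square) (top_of_set disk) polar"
    using polar_image by auto
  have "compact unit_square"
    by (intro compact_Times compact_Icc)
  then show "closed_map (top_of_set unit_square) (top_of_set disk) polar"
    using cont
    by (intro continuous_imp_closed_map) (auto simp: compact_space_subtopology Hausdorff_space_subtopology)
qed (use polar_image in simp)

section \<open>The null-homotopy\<close>

text \<open>As \<open>s\<close> runs through [0,1], the clocks \<open>ramp 0\<close>, \<open>ramp 1\<close>, \<open>ramp 2\<close> run from 0 to 1 one after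
  the other.\<close>

definition ramp :: "nat \<Rightarrow> real \<Rightarrow> real"
  where "ramp i s = max 0 (min 1 (3 * s - real i))"

text \<open>Clock \<open>j\<close> takes point \<open>j\<close> through a full turn and its cyclic
  predecessor through the fraction \<open>t\<close> of one. In the end every point has turned by
  \<open>1 + t\<close>, so all three meet at \<open>circ t\<close>.\<close>

definition filling :: "real \<times> real \<Rightarrow> (real ^ 2) set"
  where "filling = (\<lambda>(s, t). (\<lambda>i. circ (ramp i s + t * ramp (Suc i mod 3) s)) ` {..<3})"

lemma filling_eq:
  "filling (s, t) =
    {circ (ramp 0 s + t * ramp 1 s), circ (ramp 1 s + t * ramp 2 s), circ (ramp 2 s + t * ramp 0 s)}"
proof -
  have "{..<3} = {0, 1, 2::nat}"
    by auto
  then show ?thesis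
    by (simp add: filling_def flip: numeral_2_eq_2)
qed

lemma continuous_map_filling: "continuous_map (top_of_set unit_square) (Sub_topology 3 disk) filling"
  unfolding filling_def case_prod_unfold
proof (rule continuous_map_image_Sub)
  fix i
  have "continuous_on unit_square (\<lambda>p. circ (ramp i (fst p) + snd p * ramp (Suc i mod 3) (fst p)))"
    unfolding ramp_def by (intro continuous_intros)
  then show "continuous_map (top_of_set unit_square) (top_of_set disk)
      (\<lambda>p. circ (ramp i (fst p) + snd p * ramp (Suc i mod 3) (fst p)))"
    by auto
qed (auto simp: lessThan_empty_iff)

lemma filling_centre: "filling (0, t) = {circ 0}"
  by (simp add: filling_eq ramp_def)

text \<open>At each time at most one clock \<open>x\<close> is off the integers, so both sides are \<open>{circ 0, circ x}\<close>,
  where the moving point is single at \<open>t = 0\<close> and double at \<open>t = 1\<close>.\<close>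

lemma filling_periodic: "filling (s, 1) = filling (s, 0)"
proof -
  consider "s \<le> 1/3" | "1/3 \<le> s" "s \<le> 2/3" | "2/3 \<le> s"
    by linarith
  then show ?thesis
  proof cases
    case 1
    then have "ramp 1 s = 0" "ramp 2 s = 0"
      by (auto simp: ramp_def)
    then show ?thesis
      by (auto simp: filling_eq)
  next
    case 2
    then have "ramp 0 s = 1" "ramp 2 s = 0"
      by (auto simp: ramp_def)
    then show ?thesis
      by (auto simp: filling_eq)
  next
    case 3
    then have "ramp 0 s = 1" "ramp 1 s = 1"
      by (auto simp: ramp_def)
    then show ?thesis
      \<comment> \<open>For \<open>t = 1\<close> point 0 has made two full turns here, hence the
        reduction of \<open>circ (1 + 1)\<close>.\<close>
      using circ_add_1[of 1] by (auto simp: filling_eq add.commute[of "ramp 2 s" 1])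
  qed
qed

lemma filling_boundary: "filling (1, t) = {circ t}"
  by (simp add: filling_eq ramp_def)

text \<open>On the square, \<open>polar\<close> only collapses the side \<open>s = 0\<close> and
  glues \<open>(s, 0)\<close> to \<open>(s, 1)\<close>; \<open>filling_centre\<close> and
  \<open>filling_periodic\<close> cover these identifications.\<close>

lemma filling_cong:
  assumes "p \<in> unit_square" "q \<in> unit_square" "polar p = polar q"
  shows "filling p = filling q"
proof -
  obtain s t s' t' where pq: "p = (s, t)" "q = (s', t')"
    by (cases p, cases q)
  have bounds: "0 \<le> s" "0 \<le> t" "t \<le> 1" "0 \<le> s'" "0 \<le> t'" "t' \<le> 1"
    using assms pq by auto
  have eq: "s *\<^sub>R circ t = s' *\<^sub>R circ t'"
    using assms pq by (simp add: polar_def)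
  from arg_cong[OF this, of norm] have s: "s' = s"
    using bounds by simp
  show ?thesis
  proof (cases "s = 0")
    case True
    then show ?thesis
      by (simp add: pq s filling_centre)
  next
    case False
    then have "circ t = circ t'"
      using eq s by simp
    then obtain n :: int where n: "t = t' + n"
      by (auto simp: circ_eq_iff)
    then have "n = -1 \<or> n = 0 \<or> n = 1"
      using bounds by linarith
    then consider "t = t'" | "t = 0" "t' = 1" | "t = 1" "t' = 0"
      using n bounds by fastforce
    then show ?thesis
      by cases (auto simp: pq s filling_periodic)
  qed
qed

section \<open>The projection in homology\<close>

lemma trivial_homomorphism_proj_if_singleton_on_boundary:
  assumes sphere: "\<And>x. x \<in> disk \<Longrightarrow> g x \<subseteq> sphere 0 1"
    and boundary: "\<And>x. x \<in> sphere 0 1 \<Longrightarrow> g x = {x}"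
  shows "trivial_homomorphism (gr_homology g) disk_homology (proj_induced g)"
proof -
  let ?S = "sphere 0 1 :: (real ^ 2) set"
  let ?G = "relative_homology_group 2 (top_of_set (gr g)) (gr_bd g)"
  let ?ind = "hom_induced 2 (top_of_set (gr g)) (gr_bd g)"
  have "homotopic_with (\<lambda>h. h \<in> gr_bd g \<rightarrow> ?S) (top_of_set (gr g)) (top_of_set disk) fst snd"
    unfolding homotopic_with_def
  proof (intro exI conjI ballI allI)
    let ?h = "\<lambda>(u::real, p::(real ^ 2) \<times> (real ^ 2)). (1 - u) *\<^sub>R fst p + u *\<^sub>R snd p"
    have "continuous_on ({0..1} \<times> gr g) ?h"
      by (auto simp: case_prod_unfold intro!: continuous_intros)
    moreover have "?h ` ({0..1} \<times> gr g) \<subseteq> disk"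
    proof clarify
      fix u :: real and a b
      assume "u \<in> {0..1}" "(a, b) \<in> gr g"
      then show "(1 - u) *\<^sub>R fst (a, b) + u *\<^sub>R snd (a, b) \<in> disk"
        using convexD_alt[OF convex_cball, of a 0 1 b u] by (auto simp: gr_def)
    qed
    ultimately show "continuous_map (prod_topology (top_of_set {0..1}) (top_of_set (gr g))) (top_of_set disk) ?h"
      by (auto simp: prod_topology_subtopology_eu)
    show "(\<lambda>p. ?h (u, p)) \<in> gr_bd g \<rightarrow> ?S" if "u \<in> {0..1}" for u
    proof
      fix p assume "p \<in> gr_bd g"
      then have "snd p = fst p" "fst p \<in> ?S"
        using boundary by (auto simp: gr_bd_def gr_def)
      then show "?h (u, p) \<in> ?S"
        by (simp flip: scaleR_left_distrib)
    qed
  qed auto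
  then have fst_snd: "proj_induced g = ?ind (top_of_set disk) ?S snd"
    unfolding proj_induced_def by (rule homology_homotopy_axiom)
  \<comment> \<open>By \<open>sphere\<close>, all of \<open>gr g\<close> is sent to the circle, so
    the target can be the pair (circle, circle); \<open>id\<close> below includes that pair in
    (disk, circle).\<close>
  have snd: "continuous_map (top_of_set (gr g)) (top_of_set ?S) snd" "snd \<in> gr_bd g \<rightarrow> ?S"
    using sphere by (fastforce simp: gr_def gr_bd_def intro: continuous_intros)+
  have id: "continuous_map (top_of_set ?S) (top_of_set disk) id" "id \<in> ?S \<rightarrow> ?S"
    by auto
  have "?ind (top_of_set disk) ?S snd c = \<one>\<^bsub>disk_homology\<^esub>" for c
  proof -
    \<comment> \<open>\<open>c\<close> is arbitrary: \<open>hom_induced\<close> takes its values in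
      the carrier even at arguments outside the group.\<close>
    have "?ind (top_of_set ?S) ?S snd c \<in> carrier (relative_homology_group 2 (top_of_set ?S) ?S)"
      by (rule hom_induced_carrier)
    then have "?ind (top_of_set ?S) ?S snd c = \<one>\<^bsub>relative_homology_group 2 (top_of_set ?S) ?S\<^esub>"
      using trivial_relative_homology_group_topspace[of 2 "top_of_set ?S"]
      by (auto simp: trivial_group_def)
    then have "hom_induced 2 (top_of_set ?S) ?S (top_of_set disk) ?S id (?ind (top_of_set ?S) ?S snd c)
        = \<one>\<^bsub>disk_homology\<^esub>"
      unfolding disk_homology_def by (metis hom_induced_hom hom_one group_relative_homology_group)
    then show ?thesis
      using hom_induced_compose'[OF snd id, of 2 c] by simp
  qed
  then show ?thesis
    using fst_snd
    by (auto simp: trivial_homomorphism_def gr_homology_def disk_homology_def proj_induced_def hom_induced_hom)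
qed

text \<open>A selection is a relative cycle, so its class lies in the group on which the projection
  is trivial, against the last clause of \<open>homological_selection\<close>.\<close>

lemma not_homological_selection_if_trivial_homomorphism:
  assumes "trivial_homomorphism (gr_homology g) disk_homology (proj_induced g)"
  shows "\<not> homological_selection g c"
proof
  assume c: "homological_selection g c"
  \<comment> \<open>Relative cycles have their boundary in a subspace of \<open>gr g\<close>,
    selections in a subspace of the plane product; the two topologies on \<open>gr_bd g\<close>
    agree.\<close>
  have "subtopology (top_of_set (gr g)) (gr_bd g) = top_of_set (gr_bd g)"
    by (auto simp: subtopology_subtopology gr_bd_def Int_absorb1 intro!: arg_cong[of _ _ "subtopology euclidean"])
  with c have "singular_relcycle 2 (top_of_set (gr g)) (gr_bd g) c"
    by (simp add: homological_selection_def singular_relcycle)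
  then have "homologous_rel_set 2 (top_of_set (gr g)) (gr_bd g) c \<in> carrier (gr_homology g)"
    using carrier_relative_homology_group[of 2 "top_of_set (gr g)" "gr_bd g"]
    by (auto simp: gr_homology_def)
  with assms c show False
    by (auto simp: trivial_homomorphism_def homological_selection_def)
qed

theorem mainTheorem3:
  shows "\<exists>g :: real ^ 2 \<Rightarrow> (real ^ 2) set.
    continuous_map (top_of_set disk) (Sub_topology 3 disk) g \<and>
    (\<nexists>c. homological_selection g c) \<and>
    trivial_homomorphism (gr_homology g) disk_homology (proj_induced g)"
proof -
  \<comment> \<open>\<open>filling\<close> is constant on the fibres of the quotient map
    \<open>polar\<close>, so it descends to the disk.\<close>
  obtain g where cont: "continuous_map (top_of_set disk) (Sub_topology 3 disk) g"
    and g: "\<And>p. p \<in> unit_square \<Longrightarrow> g (polar p) = filling p"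
    using quotient_map_lift_exists[OF quotient_map_polar continuous_map_filling] filling_cong
    by (metis topspace_euclidean_subtopology)
  have "g x \<subseteq> sphere 0 1" if "x \<in> disk" for x
  proof -
    obtain p where "p \<in> unit_square" "x = polar p"
      using \<open>x \<in> disk\<close> polar_image by blast
    then show ?thesis
      by (auto simp: g filling_def)
  qed
  moreover have "g x = {x}" if "x \<in> sphere 0 1" for x
  proof -
    obtain t where "0 \<le> t" "t \<le> 1" "x = circ t"
      using \<open>x \<in> sphere 0 1\<close> by (auto elim: sphere_imp_circ)
    then show ?thesis
      \<comment> \<open>The boundary circle is the image of the side \<open>s = 1\<close>.\<close>
      using g[of "(1, t)"] by (simp add: polar_def filling_boundary)
  qed
  ultimately have "trivial_homomorphism (gr_homology g) disk_homology (proj_induced g)"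
    by (rule trivial_homomorphism_proj_if_singleton_on_boundary)
  then show ?thesis
    using cont not_homological_selection_if_trivial_homomorphism by blast
qed

end
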